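(* Let $\lambda_1,\lambda_2,\lambda_3\in\mathbb{R}$ and let $\mathbb{K}$ be the associated algebra of 3-parameter generalized quaternions. Then $\mathrm{Im}(\mathbb{K})=\{a_1e_1+a_2e_2+a_3e_3:a_1,a_2,a_3\in\mathbb{R}\}$ is the Lie algebra of the Lie group $S_{\mathbb{K}}=\{p\in\mathbb{K}:N_p=1\}$; that is, the tangent space $T_{S_{\mathbb{K}}}(e)$ at the identity $e=1$, regarded as a subspace of $\mathbb{K}$, is $\mathrm{Im}(\mathbb{K})$.
   Context: Given $\lambda_1,\lambda_2,\lambda_3\in\mathbb{R}$, $\mathbb{K}$ is the (associative, unital) real algebra with vector-space basis $1,e_1,e_2,e_3$, unit $1$, and bilinear multiplication determined by $e_1^2=-\lambda_1\lambda_2$, $e_2^2=-\lambda_1\lambda_3$, $e_3^2=-\lambda_2\lambda_3$, $e_1e_2=\lambda_1e_3=-e_2e_1$, $e_2e_3=\lambda_3e_1=-e_3e_2$, $e_3e_1=\lambda_2e_2=-e_1e_3$. For $p=a_0+a_1e_1+a_2e_2+a_3e_3\in\mathbb{K}$ (with $a_i\in\mathbb{R}$), the norm is $N_p=a_0^2+\lambda_1\lambda_2a_1^2+\lambda_1\lambda_3a_2^2+\lambda_2\lambda_3a_3^2$. $S_{\mathbb{K}}$ is a 3-dimensional Lie group under the multiplication of $\mathbb{K}$, with the smooth structure of an embedded submanifold of $\mathbb{K}\cong\mathbb{R}^4$; tangent vectors at $1$ are velocity vectors $\rho'(0)\in\mathbb{K}$ of smooth curves $\rho$ in $S_{\mathbb{K}}$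 with $\rho(0)=1$. *)

theory Defs
  imports "HOL-Analysis.Analysis" "HOL-Algebra.Group"
begin

(* The algebra \<K> of 3-parameter generalized quaternions lives on real^4. In the index type 4
   the numeral 4 equals 0, so the indices are 0, 1, 2, 3 and p $ i is the coefficient a_i of
   p = a_0 + a_1 e_1 + a_2 e_2 + a_3 e_3. Beware that the overloaded 1 :: real^4 has all
   components equal to 1; the unit of the algebra is gq_basis 0. *)

definition gq_basis :: "4 \<Rightarrow> real^4" where
  "gq_basis i = axis i 1"

definition gq :: "real \<Rightarrow> real \<Rightarrow> real \<Rightarrow> real \<Rightarrow> real^4" where
  "gq a0 a1 a2 a3 =
     a0 *\<^sub>R gq_basis 0 + a1 *\<^sub>R gq_basis 1 + a2 *\<^sub>R gq_basis 2 + a3 *\<^sub>R gq_basis 3"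

(* The bilinear extension of the multiplication table of the basis; see gq_mult_table and
   bilinear_gq_mult, which together determine it. *)
definition gq_mult :: "real \<Rightarrow> real \<Rightarrow> real \<Rightarrow> real^4 \<Rightarrow> real^4 \<Rightarrow> real^4" where
  "gq_mult l1 l2 l3 p q = gq
     (p$0 * q$0 - l1 * l2 * (p$1 * q$1) - l1 * l3 * (p$2 * q$2) - l2 * l3 * (p$3 * q$3))
     (p$0 * q$1 + p$1 * q$0 + l3 * (p$2 * q$3 - p$3 * q$2))
     (p$0 * q$2 + p$2 * q$0 + l2 * (p$3 * q$1 - p$1 * q$3))
     (p$0 * q$3 + p$3 * q$0 + l1 * (p$1 * q$2 - p$2 * q$1))"

definition gq_norm :: "real \<Rightarrow> real \<Rightarrow> real \<Rightarrow> real^4 \<Rightarrow> real" where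
  "gq_norm l1 l2 l3 p =
     (p$0)\<^sup>2 + l1 * l2 * (p$1)\<^sup>2 + l1 * l3 * (p$2)\<^sup>2 + l2 * l3 * (p$3)\<^sup>2"

definition gq_Im :: "(real^4) set" where
  "gq_Im = {a1 *\<^sub>R gq_basis 1 + a2 *\<^sub>R gq_basis 2 + a3 *\<^sub>R gq_basis 3 | a1 a2 a3. True}"

definition gq_sphere :: "real \<Rightarrow> real \<Rightarrow> real \<Rightarrow> (real^4) monoid" where
  "gq_sphere l1 l2 l3 =
     \<lparr>carrier = {p. gq_norm l1 l2 l3 p = 1}, mult = gq_mult l1 l2 l3, one = gq_basis 0\<rparr>"

(* C-infinity on an open set of parameters: every iterated derivative exists and is itself
   differentiable there. *)
definition smooth_curve_on :: "real set \<Rightarrow> (real \<Rightarrow> 'a::real_normed_vector) \<Rightarrow> bool" where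
  "smooth_curve_on T \<rho> \<longleftrightarrow>
     (\<forall>k. \<forall>t\<in>T. ((\<lambda>f s. vector_derivative f (at s)) ^^ k) \<rho> differentiable (at t))"

(* For an embedded submanifold S, a curve with values in S is smooth as a map into S iff it is
   smooth as a map into the ambient space, so this is the tangent space of S at p, regarded as a
   subset of the ambient space. *)
definition tangent_space :: "'a::real_normed_vector set \<Rightarrow> 'a \<Rightarrow> 'a set" where
  "tangent_space S p = {v. \<exists>\<rho> \<epsilon>. 0 < \<epsilon> \<and> smooth_curve_on {-\<epsilon><..<\<epsilon>} \<rho> \<and>
     (\<forall>t\<in>{-\<epsilon><..<\<epsilon>}. \<rho> t \<in> S) \<and> \<rho> 0 = p \<and> v = vector_derivative \<rho> (at 0)}"

lemma UNIV_gq: "(UNIV :: 4 set) = {0, 1, 2, 3}"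
proof -
  have "(4::4) = 0" by simp
  then show ?thesis using UNIV_4 by auto
qed

lemma forall_gq: "(\<forall>i::4. P i) \<longleftrightarrow> P 0 \<and> P 1 \<and> P 2 \<and> P 3"
  by (metis UNIV_I UNIV_gq empty_iff insert_iff)

lemma gq_basis_nth: "gq_basis i $ j = (if j = i then 1 else 0)"
  by (simp add: gq_basis_def axis_def)

lemma gq_nth [simp]:
  "gq a0 a1 a2 a3 $ 0 = a0" "gq a0 a1 a2 a3 $ 1 = a1"
  "gq a0 a1 a2 a3 $ 2 = a2" "gq a0 a1 a2 a3 $ 3 = a3"
  by (simp_all add: gq_def gq_basis_nth)

lemma gq_eq_iff: "p = q \<longleftrightarrow> p$0 = q$0 \<and> p$1 = q$1 \<and> p$2 = q$2 \<and> p$3 = (q::real^4)$3"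
  by (simp add: vec_eq_iff forall_gq)

lemma gq_mult_table:
  defines "e \<equiv> gq_basis"
  shows "gq_mult l1 l2 l3 (e 0) p = p" "gq_mult l1 l2 l3 p (e 0) = p"
    "gq_mult l1 l2 l3 (e 1) (e 1) = (- l1 * l2) *\<^sub>R e 0"
    "gq_mult l1 l2 l3 (e 2) (e 2) = (- l1 * l3) *\<^sub>R e 0"
    "gq_mult l1 l2 l3 (e 3) (e 3) = (- l2 * l3) *\<^sub>R e 0"
    "gq_mult l1 l2 l3 (e 1) (e 2) = l1 *\<^sub>R e 3" "gq_mult l1 l2 l3 (e 2) (e 1) = - (l1 *\<^sub>R e 3)"
    "gq_mult l1 l2 l3 (e 2) (e 3) = l3 *\<^sub>R e 1" "gq_mult l1 l2 l3 (e 3) (e 2) = - (l3 *\<^sub>R e 1)"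
    "gq_mult l1 l2 l3 (e 3) (e 1) = l2 *\<^sub>R e 2" "gq_mult l1 l2 l3 (e 1) (e 3) = - (l2 *\<^sub>R e 2)"
  by (simp_all add: e_def gq_eq_iff gq_mult_def gq_basis_nth)

lemma bilinear_gq_mult: "bilinear (gq_mult l1 l2 l3)"
  unfolding bilinear_def by (auto intro!: linearI simp: gq_eq_iff gq_mult_def algebra_simps)

lemma gq_mult_assoc:
  "gq_mult l1 l2 l3 (gq_mult l1 l2 l3 p q) r = gq_mult l1 l2 l3 p (gq_mult l1 l2 l3 q r)"
  by (simp add: gq_eq_iff gq_mult_def algebra_simps)

lemma gq_norm_mult:
  "gq_norm l1 l2 l3 (gq_mult l1 l2 l3 p q) = gq_norm l1 l2 l3 p * gq_norm l1 l2 l3 q"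
  by (simp add: gq_norm_def gq_mult_def algebra_simps power2_eq_square)

(* The inverse of p in the group is its conjugate. *)
lemma group_gq_sphere: "group (gq_sphere l1 l2 l3)"
proof (rule groupI)
  fix p assume "p \<in> carrier (gq_sphere l1 l2 l3)"
  then have "gq_norm l1 l2 l3 p = 1" by (simp add: gq_sphere_def)
  then show "\<exists>q\<in>carrier (gq_sphere l1 l2 l3). q \<otimes>\<^bsub>gq_sphere l1 l2 l3\<^esub> p = \<one>\<^bsub>gq_sphere l1 l2 l3\<^esub>"
    by (intro bexI[of _ "gq (p$0) (- p$1) (- p$2) (- p$3)"])
      (simp_all add: gq_sphere_def gq_eq_iff gq_mult_def gq_norm_def gq_basis_nth
        power2_eq_square algebra_simps)
next
  show "\<one>\<^bsub>gq_sphere l1 l2 l3\<^esub> \<in> carrier (gq_sphere l1 l2 l3)"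
    by (simp add: gq_sphere_def gq_norm_def gq_basis_nth)
qed (simp_all add: gq_sphere_def gq_norm_mult gq_mult_assoc gq_mult_table)

(* Hence the group is a closed embedded hypersurface: 1 is a regular value of the norm. *)
lemma gq_norm_regular:
  assumes "p \<in> carrier (gq_sphere l1 l2 l3)"
  shows "\<exists>D. (gq_norm l1 l2 l3 has_derivative D) (at p) \<and> surj D"
proof (intro exI conjI)
  let ?D = "\<lambda>h::real^4. 2 * p$0 * h$0 + l1 * l2 * (2 * p$1 * h$1) + l1 * l3 * (2 * p$2 * h$2)
    + l2 * l3 * (2 * p$3 * h$3)"
  show "(gq_norm l1 l2 l3 has_derivative ?D) (at p)"
    unfolding gq_norm_def[abs_def]
    by (auto intro!: derivative_eq_intros bounded_linear_imp_has_derivative[OF bounded_linear_vec_nth]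
      simp: algebra_simps fun_eq_iff)
  have "?D ((c / 2) *\<^sub>R p) = c * gq_norm l1 l2 l3 p" for c
    by (simp add: gq_norm_def algebra_simps power2_eq_square)
  then have "?D ((c / 2) *\<^sub>R p) = c" for c
    using assms by (simp add: gq_sphere_def)
  then show "surj ?D" by (rule surjI[where f = "\<lambda>c. (c / 2) *\<^sub>R p"])
qed

end

theory Submission
  imports Defs
begin

text \<open>
  One inclusion differentiates the equation \<open>N = 1\<close> along a curve through the unit: the
  derivative of \<open>N\<close> at the unit is \<open>h \<mapsto> 2 h\<^sub>0\<close>, so the velocity has real part zero.

  For the other inclusion, every imaginary \<open>v\<close> has to be the velocity of a smooth curve in the
  sphere, and the one-parameter subgroup \<open>exp (t v)\<close> is such a curve. Since \<open>v\<^sup>2 = - N\<^sub>v\<close> is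
  a real scalar, the exponential series collapses to \<open>C t + S t \<cdot> v\<close>, where \<open>C\<close> and \<open>S\<close> are the
  solutions of \<open>C' = - N\<^sub>v S\<close>, \<open>S' = C\<close> with \<open>C 0 = 1\<close>, \<open>S 0 = 0\<close>: trigonometric, affine or
  hyperbolic functions according to the sign of \<open>N\<^sub>v\<close>. Its norm is \<open>C\<^sup>2 + N\<^sub>v S\<^sup>2 = 1\<close>, and it
  solves the linear equation \<open>\<rho>' = \<rho> v\<close>, which makes it smooth.
\<close>

text \<open>
  Differentiating the equation \<open>\<rho>' = L \<rho>\<close> repeatedly shows that the \<open>k\<close>-th derivative is
  \<open>L\<^sup>k \<rho>\<close>, which is again differentiable.
\<close>

lemma smooth_curve_on_linear_ode:
  assumes L: "bounded_linear L"
    and ode: "\<And>t. (\<rho> has_vector_derivative L (\<rho> t)) (at t)"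
  shows "smooth_curve_on T \<rho>"
proof -
  have deriv: "((\<lambda>s. (L ^^ k) (\<rho> s)) has_vector_derivative (L ^^ Suc k) (\<rho> t)) (at t)" for k t
  proof (induction k)
    case 0
    then show ?case using ode by simp
  next
    case (Suc k)
    then show ?case
      using bounded_linear.has_vector_derivative[OF L Suc] by simp
  qed
  have "((\<lambda>f s. vector_derivative f (at s)) ^^ k) \<rho> = (\<lambda>s. (L ^^ k) (\<rho> s))" for k
  proof (induction k)
    case (Suc k)
    then show ?case
      using vector_derivative_at[OF deriv[of k]] by simp
  qed simp
  then show ?thesis
    unfolding smooth_curve_on_def
    using deriv differentiableI_vector by metis
qed

text \<open>
  Uniform stand-ins for \<open>cos (\<surd>k t)\<close> and \<open>sin (\<surd>k t) / \<surd>k\<close> that cover all signs of \<open>k\<close>.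
\<close>

lemma generalized_cos_sin_exist:
  fixes k :: real
  obtains C S :: "real \<Rightarrow> real"
  where "\<And>t. (C has_real_derivative - k * S t) (at t)"
    and "\<And>t. (S has_real_derivative C t) (at t)"
    and "C 0 = 1" and "S 0 = 0"
    and "\<And>t. (C t)\<^sup>2 + k * (S t)\<^sup>2 = 1"
proof (cases k "0 :: real" rule: linorder_cases)
  case equal
  show ?thesis
    by (rule that[of "\<lambda>_. 1" "\<lambda>t. t"]) (use equal in \<open>auto intro!: derivative_eq_intros\<close>)
next
  case greater
  define w where "w = sqrt k"
  have w: "w \<noteq> 0" "k = w * w" using greater by (auto simp: w_def)
  show ?thesis
  proof (rule that[of "\<lambda>t. cos (w * t)" "\<lambda>t. sin (w * t) / w"])
    show "(cos (w * t))\<^sup>2 + k * (sin (w * t) / w)\<^sup>2 = 1" for t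
      using w by (simp add: power_divide flip: power2_eq_square)
  qed (use w in \<open>auto intro!: derivative_eq_intros\<close>)
next
  case less
  define w where "w = sqrt (- k)"
  have w: "w \<noteq> 0" "k = - (w * w)" using less by (auto simp: w_def)
  show ?thesis
  proof (rule that[of "\<lambda>t. cosh (w * t)" "\<lambda>t. sinh (w * t) / w"])
    show "(cosh (w * t))\<^sup>2 + k * (sinh (w * t) / w)\<^sup>2 = 1" for t
      using w by (simp add: power_divide cosh_square_eq flip: power2_eq_square)
  qed (use w in \<open>auto intro!: derivative_eq_intros\<close>)
qed

lemma gq_Im_iff: "v \<in> gq_Im \<longleftrightarrow> v $ 0 = 0"
  by (auto simp: gq_Im_def gq_eq_iff gq_basis_nth)

text \<open>
  The derivative of the norm at the unit annihilates exactly the imaginary elements, and it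
  vanishes on the velocity of a curve along which the norm is constant.
\<close>

lemma tangent_space_gq_sphere_subset:
  "tangent_space {p. gq_norm l1 l2 l3 p = 1} (gq_basis 0) \<subseteq> gq_Im"
proof
  fix v assume "v \<in> tangent_space {p. gq_norm l1 l2 l3 p = 1} (gq_basis 0)"
  then obtain \<rho> \<epsilon> where \<epsilon>: "0 < \<epsilon>" and smooth: "smooth_curve_on {-\<epsilon><..<\<epsilon>} \<rho>"
    and N: "\<And>t. t \<in> {-\<epsilon><..<\<epsilon>} \<Longrightarrow> gq_norm l1 l2 l3 (\<rho> t) = 1"
    and \<rho>0: "\<rho> 0 = gq_basis 0" and v: "v = vector_derivative \<rho> (at 0)"
    by (auto simp: tangent_space_def)
  have "\<rho> differentiable (at 0)"
    using smooth \<epsilon> unfolding smooth_curve_on_def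
    by (metis funpow_0 greaterThanLessThan_iff neg_less_0_iff_less)
  then have "(\<rho> has_vector_derivative v) (at 0)"
    by (simp add: v vector_derivative_works)
  then have coord: "((\<lambda>t. \<rho> t $ i) has_real_derivative v $ i) (at 0)" for i
    unfolding has_real_derivative_iff_has_vector_derivative
    by (rule bounded_linear.has_vector_derivative[OF bounded_linear_vec_nth])
  have "((\<lambda>t. gq_norm l1 l2 l3 (\<rho> t)) has_real_derivative 2 * v $ 0) (at 0)"
    unfolding gq_norm_def
    by (auto intro!: derivative_eq_intros coord simp: \<rho>0 gq_basis_nth)
  moreover have "((\<lambda>t. gq_norm l1 l2 l3 (\<rho> t)) has_real_derivative 0) (at 0)"
    by (rule has_field_derivative_transform_within_open[of "\<lambda>_. 1" 0 0 "{-\<epsilon><..<\<epsilon>}"])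
      (use \<epsilon> N in auto)
  ultimately show "v \<in> gq_Im"
    using DERIV_unique by (fastforce simp: gq_Im_iff)
qed

text \<open>
  The imaginary element \<open>v\<close> is the initial velocity of the one-parameter subgroup
  \<open>exp (t v) = C t + S t \<cdot> v\<close>.
\<close>

lemma gq_Im_subset_tangent_space:
  "gq_Im \<subseteq> tangent_space {p. gq_norm l1 l2 l3 p = 1} (gq_basis 0)"
proof
  fix v assume "v \<in> gq_Im"
  then have v0: "v $ 0 = 0" by (simp add: gq_Im_iff)
  obtain C S where C: "\<And>t. (C has_real_derivative - gq_norm l1 l2 l3 v * S t) (at t)"
    and S: "\<And>t. (S has_real_derivative C t) (at t)"
    and C0: "C 0 = 1" and S0: "S 0 = 0"
    and CS: "\<And>t. (C t)\<^sup>2 + gq_norm l1 l2 l3 v * (S t)\<^sup>2 = 1"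
    using generalized_cos_sin_exist by blast
  define \<rho> where "\<rho> t = C t *\<^sub>R gq_basis 0 + S t *\<^sub>R v" for t
  have \<rho>0: "\<rho> 0 = gq_basis 0" by (simp add: \<rho>_def C0 S0)
  have norm: "gq_norm l1 l2 l3 (\<rho> t) = 1" for t
  proof -
    have "gq_norm l1 l2 l3 (\<rho> t) = (C t)\<^sup>2 + gq_norm l1 l2 l3 v * (S t)\<^sup>2"
      by (simp add: \<rho>_def gq_norm_def gq_basis_nth v0 power_mult_distrib algebra_simps)
    then show ?thesis using CS by simp
  qed
  \<comment> \<open>Because \<open>v\<^sup>2 = - N\<^sub>v\<close>, the product \<open>\<rho> v\<close> is \<open>- N\<^sub>v S + C v\<close>, which is \<open>\<rho>'\<close>.\<close>
  have ode: "(\<rho> has_vector_derivative gq_mult l1 l2 l3 (\<rho> t) v) (at t)" for t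
  proof -
    have "gq_mult l1 l2 l3 (\<rho> t) v = (- gq_norm l1 l2 l3 v * S t) *\<^sub>R gq_basis 0 + C t *\<^sub>R v"
      by (simp add: gq_eq_iff gq_mult_def gq_norm_def \<rho>_def gq_basis_nth v0 power2_eq_square
          algebra_simps)
    then show ?thesis
      unfolding \<rho>_def using C[of t] S[of t]
      by (auto intro!: derivative_eq_intros)
  qed
  have "bounded_linear (\<lambda>p. gq_mult l1 l2 l3 p v)"
    using bilinear_gq_mult by (auto simp: bilinear_def linear_conv_bounded_linear)
  then have "smooth_curve_on {-1<..<1} \<rho>"
    using ode by (rule smooth_curve_on_linear_ode)
  moreover have "v = vector_derivative \<rho> (at 0)"
    using vector_derivative_at[OF ode[of 0]] by (simp add: \<rho>0 gq_mult_table)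
  ultimately show "v \<in> tangent_space {p. gq_norm l1 l2 l3 p = 1} (gq_basis 0)"
    unfolding tangent_space_def using norm \<rho>0
    by (auto intro!: exI[of _ \<rho>] exI[of _ "1 :: real"])
qed

theorem theorem5p2:
  fixes l1 l2 l3 :: real
  shows "tangent_space (carrier (gq_sphere l1 l2 l3)) \<one>\<^bsub>gq_sphere l1 l2 l3\<^esub> = gq_Im"
  unfolding gq_sphere_def monoid.simps partial_object.simps
  by (rule equalityI[OF tangent_space_gq_sphere_subset gq_Im_subset_tangent_space])

end
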